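(* Let $\Phi$ be a finite irreducible crystallographic root system with simple system $\Pi$, and let $\alpha\in\Pi$. The number of roots in $\Phi_{\alpha,1}$ having the same length as $\alpha$ is $$\frac{|W_\alpha|}{|W_{\widetilde N[\alpha]}|}.$$
   Context: $\Phi$ is reduced, in a Euclidean space with Weyl-group-invariant form $(\cdot,\cdot)$. $\Phi_{\alpha,1}$ is the set of roots whose $\alpha$-coordinate with respect to $\Pi$ equals $1$. For $X\subseteq\Pi$, $W_X$ is the subgroup of the Weyl group generated by the reflections $s_\beta$ with $\beta\in\Pi\setminus X$; $W_\alpha=W_{\{\alpha\}}$. $\widetilde N[\alpha]=\{\varepsilon\in\Pi:(\varepsilon,\alpha)\ne0\}$, i.e. $\alpha$ together with its neighbours in the Dynkin diagram. *)

theory Defs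
  imports "HOL-Analysis.Analysis" "HOL-Algebra.Elementary_Groups" "HOL-Algebra.Bij"
begin

definition root_reflection :: "'a::euclidean_space \<Rightarrow> 'a \<Rightarrow> 'a" where
  "root_reflection a = (\<lambda>x. x - (2 * (x \<bullet> a) / (a \<bullet> a)) *\<^sub>R a)"

definition root_system :: "'a::euclidean_space set \<Rightarrow> bool" where
  "root_system \<Phi> \<longleftrightarrow>
     finite \<Phi> \<and> 0 \<notin> \<Phi> \<and> span \<Phi> = UNIV \<and>
     (\<forall>a\<in>\<Phi>. root_reflection a ` \<Phi> = \<Phi>)"

definition reduced_roots :: "'a::euclidean_space set \<Rightarrow> bool" where
  "reduced_roots \<Phi> \<longleftrightarrow> (\<forall>a\<in>\<Phi>. \<forall>c. c *\<^sub>R a \<in> \<Phi> \<longrightarrow> c = 1 \<or> c = -1)"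

definition crystallographic :: "'a::euclidean_space set \<Rightarrow> bool" where
  "crystallographic \<Phi> \<longleftrightarrow> (\<forall>a\<in>\<Phi>. \<forall>b\<in>\<Phi>. 2 * (b \<bullet> a) / (a \<bullet> a) \<in> \<int>)"

definition irreducible_roots :: "'a::euclidean_space set \<Rightarrow> bool" where
  "irreducible_roots \<Phi> \<longleftrightarrow>
     \<Phi> \<noteq> {} \<and>
     (\<nexists>A B. A \<noteq> {} \<and> B \<noteq> {} \<and> A \<union> B = \<Phi> \<and> A \<inter> B = {} \<and> (\<forall>a\<in>A. \<forall>b\<in>B. a \<bullet> b = 0))"

definition simple_system :: "'a::euclidean_space set \<Rightarrow> 'a set \<Rightarrow> bool" where
  "simple_system \<Phi> \<Delta> \<longleftrightarrow>
     \<Delta> \<subseteq> \<Phi> \<and> independent \<Delta> \<and> span \<Delta> = UNIV \<and>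
     (\<forall>b\<in>\<Phi>. (\<forall>a\<in>\<Delta>. representation \<Delta> b a \<in> \<int>) \<and>
            ((\<forall>a\<in>\<Delta>. representation \<Delta> b a \<ge> 0) \<or> (\<forall>a\<in>\<Delta>. representation \<Delta> b a \<le> 0)))"

definition weyl_group :: "'a::euclidean_space set \<Rightarrow> ('a \<Rightarrow> 'a) monoid" where
  "weyl_group \<Phi> = subgroup_generated (BijGroup UNIV) (root_reflection ` \<Phi>)"

text \<open>The generators are indexed by the complement of \<open>X\<close> in \<open>\<Delta>\<close>, not by \<open>X\<close>.\<close>

definition weyl_sub :: "'a::euclidean_space set \<Rightarrow> 'a set \<Rightarrow> 'a set \<Rightarrow> ('a \<Rightarrow> 'a) set" where
  "weyl_sub \<Phi> \<Delta> X = generate (weyl_group \<Phi>) (root_reflection ` (\<Delta> - X))"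

definition roots_of_coord :: "'a::euclidean_space set \<Rightarrow> 'a set \<Rightarrow> 'a \<Rightarrow> real \<Rightarrow> 'a set" where
  "roots_of_coord \<Phi> \<Delta> a k = {b \<in> \<Phi>. representation \<Delta> b a = k}"

definition closed_nbhd :: "'a::euclidean_space set \<Rightarrow> 'a \<Rightarrow> 'a set" where
  "closed_nbhd \<Delta> a = {e \<in> \<Delta>. e \<bullet> a \<noteq> 0}"

end

theory Submission
  imports Defs
begin

text \<open>The group \<open>W\<^sub>\<alpha>\<close> preserves lengths and the \<open>\<alpha>\<close>-coordinate, so the claim is the
  orbit-stabilizer theorem for \<open>\<alpha>\<close>, given the following two facts. Transitivity: in the
  \<open>W\<^sub>\<alpha>\<close>-orbit of a root with \<open>\<alpha>\<close>-coordinate 1 and the length of \<open>\<alpha>\<close>, take \<open>\<beta>\<close> of minimal height;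
  then \<open>\<beta> \<bullet> \<epsilon> \<le> 0\<close> for all simple \<open>\<epsilon> \<noteq> \<alpha>\<close>, hence \<open>\<beta> \<bullet> \<beta> \<le> \<beta> \<bullet> \<alpha>\<close>, which forces \<open>\<beta> = \<alpha>\<close> as the
  lengths agree. Stabilizer: if \<open>w \<alpha> = \<alpha>\<close> and a shortest word for \<open>w\<close> in the generators of \<open>W\<^sub>\<alpha>\<close>
  ends in \<open>s\<^sub>\<epsilon>\<close>, then \<open>w \<epsilon>\<close> is a negative root with vanishing \<open>\<alpha>\<close>-coordinate, so
  \<open>0 \<le> \<alpha> \<bullet> w \<epsilon> = \<alpha> \<bullet> \<epsilon> \<le> 0\<close>; thus \<open>s\<^sub>\<epsilon>\<close> fixes \<open>\<alpha>\<close> and induction applies to \<open>w s\<^sub>\<epsilon>\<close>.\<close>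

section \<open>Reflections and words in them\<close>

lemma linear_root_reflection: "linear (root_reflection a)"
  by (rule linearI)
    (simp_all add: root_reflection_def inner_add_left scaleR_add_left add_divide_distrib
      distrib_left algebra_simps)

lemma root_reflection_involution [simp]: "root_reflection a (root_reflection a x) = x"
  by (cases "a = 0") (simp_all add: root_reflection_def inner_diff_left algebra_simps)

lemma inner_root_reflection: "root_reflection a x \<bullet> root_reflection a y = x \<bullet> y"
  by (cases "a = 0")
    (simp_all add: root_reflection_def inner_diff_left inner_diff_right inner_commute algebra_simps)

lemma root_reflection_orthogonal: "x \<bullet> a = 0 \<Longrightarrow> root_reflection a x = x"
  by (simp add: root_reflection_def)

text \<open>Words stand in for group elements: their length carries the inductions, their letters
  record which generators occur, and reversal gives the inverse.\<close>

primrec refl_word :: "'a::euclidean_space list \<Rightarrow> 'a \<Rightarrow> 'a" where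
  "refl_word [] = id"
| "refl_word (a # as) = root_reflection a \<circ> refl_word as"

lemma refl_word_append: "refl_word (as @ bs) = refl_word as \<circ> refl_word bs"
  by (induction as) auto

lemma linear_refl_word: "linear (refl_word as)"
proof (induction as)
  case (Cons a as)
  show ?case
    unfolding refl_word.simps by (rule linear_compose [OF Cons linear_root_reflection])
qed (simp only: refl_word.simps linear_id)

lemma inner_refl_word: "refl_word as x \<bullet> refl_word as y = x \<bullet> y"
  by (induction as) (auto simp: inner_root_reflection)

lemma norm_refl_word: "norm (refl_word as x) = norm x"
  by (simp add: norm_eq_sqrt_inner inner_refl_word)

lemma refl_word_rev [simp]: "refl_word (rev as) (refl_word as x) = x"
  by (induction as arbitrary: x) (auto simp: refl_word_append)

lemma refl_word_rev' [simp]: "refl_word as (refl_word (rev as) x) = x"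
  using refl_word_rev [of "rev as"] by simp

lemma bij_refl_word: "bij (refl_word as)"
  by (rule o_bij [of "refl_word (rev as)"]) auto

text \<open>An isometry w carries the hyperplane orthogonal to a to the one orthogonal to w a. This
  is what cancels a letter in \<open>exchange\<close>.\<close>

lemma refl_word_conjugate:
  "refl_word as \<circ> root_reflection a = root_reflection (refl_word as a) \<circ> refl_word as"
proof
  fix x
  show "(refl_word as \<circ> root_reflection a) x = (root_reflection (refl_word as a) \<circ> refl_word as) x"
    by (simp add: root_reflection_def inner_refl_word linear_diff [OF linear_refl_word]
        linear_scale [OF linear_refl_word])
qed

section \<open>Reflection subgroups as sets of words, and orbit counting\<close>

context
  fixes \<Phi> \<Delta> :: "'a::euclidean_space set"
  assumes \<Phi>: "root_system \<Phi>" and \<Delta>: "\<Delta> \<subseteq> \<Phi>"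
begin

lemma root_reflection_closed: "a \<in> \<Delta> \<Longrightarrow> b \<in> \<Phi> \<Longrightarrow> root_reflection a b \<in> \<Phi>"
  using \<Phi> \<Delta> unfolding root_system_def by blast

lemma refl_word_closed: "as \<in> lists \<Delta> \<Longrightarrow> b \<in> \<Phi> \<Longrightarrow> refl_word as b \<in> \<Phi>"
  by (induction as) (auto intro: root_reflection_closed)

lemma weyl_sub_eq_words: "weyl_sub \<Phi> \<Delta> X = refl_word ` lists (\<Delta> - X)"
proof -
  let ?B = "BijGroup (UNIV :: 'a set)"
  let ?W = "weyl_group \<Phi>"
  interpret B: group ?B by (rule group_BijGroup)
  interpret W: group ?W
    unfolding weyl_group_def by (rule B.group_subgroup_generated)
  have Bij: "bij f \<Longrightarrow> f \<in> Bij UNIV" for f :: "'a \<Rightarrow> 'a"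
    by (simp add: Bij_def extensional_def)
  \<comment> \<open>Multiplication in \<open>BijGroup\<close> is restricted to
    \<open>Bij UNIV\<close>, so it is known to be composition only for bijections.\<close>
  have mult: "f \<otimes>\<^bsub>?W\<^esub> g = f \<circ> g" if "bij f" "bij g" for f g
    using that by (auto simp: weyl_group_def BijGroup_def Bij compose_def fun_eq_iff)
  have unit: "\<one>\<^bsub>?W\<^esub> = id"
    by (simp add: weyl_group_def BijGroup_def fun_eq_iff restrict_def)
  have bij: "bij (root_reflection a)" for a :: 'a
    using bij_refl_word [of "[a]"] by simp
  have car: "root_reflection a \<in> carrier ?W" if "a \<in> \<Delta>" for a
    using that \<Delta> bij Bij
    by (auto simp: weyl_group_def carrier_subgroup_generated BijGroup_def intro!: generate.incl)
  have inv_refl: "inv\<^bsub>?W\<^esub> root_reflection a = root_reflection a" if "a \<in> \<Delta>" for a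
    by (rule W.inv_equality) (use that in \<open>auto simp: car mult bij unit\<close>)
  show ?thesis
  proof
    show "weyl_sub \<Phi> \<Delta> X \<subseteq> refl_word ` lists (\<Delta> - X)"
    proof
      fix f assume "f \<in> weyl_sub \<Phi> \<Delta> X"
      then show "f \<in> refl_word ` lists (\<Delta> - X)"
        unfolding weyl_sub_def
      proof induction
        case one
        show ?case by (auto simp: unit intro!: image_eqI [of _ _ "[]"])
      next
        case (incl h)
        then obtain a where "a \<in> \<Delta> - X" "h = root_reflection a" by auto
        then show ?case by (auto intro!: image_eqI [of _ _ "[a]"])
      next
        case (inv h)
        then obtain a where "a \<in> \<Delta> - X" "h = root_reflection a" by auto
        then show ?case by (auto simp: inv_refl intro!: image_eqI [of _ _ "[a]"])
      next
        case (eng h1 h2)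
        then obtain as bs where "as \<in> lists (\<Delta> - X)" "h1 = refl_word as"
          "bs \<in> lists (\<Delta> - X)" "h2 = refl_word bs" by auto
        then show ?case
          by (intro image_eqI [of _ _ "as @ bs"])
            (simp_all add: mult bij_refl_word refl_word_append)
      qed
    qed
    have "refl_word as \<in> weyl_sub \<Phi> \<Delta> X" if "as \<in> lists (\<Delta> - X)" for as
      using that
    proof induction
      case Nil
      then show ?case by (simp add: weyl_sub_def generate.one flip: unit)
    next
      case (Cons a as)
      then have "root_reflection a \<otimes>\<^bsub>?W\<^esub> refl_word as \<in> weyl_sub \<Phi> \<Delta> X"
        unfolding weyl_sub_def by (intro generate.eng) (auto intro: generate.incl)
      then show ?case by (simp only: mult bij bij_refl_word refl_word.simps)
    qed
    then show "refl_word ` lists (\<Delta> - X) \<subseteq> weyl_sub \<Phi> \<Delta> X" by auto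
  qed
qed

text \<open>The elements are linear and map \<Phi> into itself; since \<Phi> spans, each is
  determined by its restriction to this finite set.\<close>

lemma finite_weyl_sub: "finite (weyl_sub \<Phi> \<Delta> X)"
proof -
  have "inj_on (\<lambda>f. restrict f \<Phi>) (weyl_sub \<Phi> \<Delta> X)"
  proof (rule inj_onI)
    fix f g assume "f \<in> weyl_sub \<Phi> \<Delta> X" "g \<in> weyl_sub \<Phi> \<Delta> X"
      and eq: "restrict f \<Phi> = restrict g \<Phi>"
    then have lin: "linear f" "linear g"
      by (auto simp: weyl_sub_eq_words linear_refl_word)
    have on: "f b = g b" if "b \<in> \<Phi>" for b
      using fun_cong [OF eq, of b] that by simp
    have "f x = g x" for x
      by (rule linear_eq_on_span [OF lin on, of \<Phi>]) (use \<Phi> in \<open>auto simp: root_system_def\<close>)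
    then show "f = g" ..
  qed
  moreover have "(\<lambda>f. restrict f \<Phi>) ` weyl_sub \<Phi> \<Delta> X \<subseteq> \<Phi> \<rightarrow>\<^sub>E \<Phi>"
    by (auto simp: weyl_sub_eq_words intro!: refl_word_closed)
  moreover have "finite (\<Phi> \<rightarrow>\<^sub>E \<Phi>)"
    using \<Phi> by (auto simp: root_system_def intro: finite_PiE)
  ultimately show ?thesis
    by (meson finite_imageD finite_subset)
qed

text \<open>Evaluation at v splits the group into fibres. The fibre over u v is the translate of the
  stabilizer by u, so all fibres have the same size.\<close>

lemma weyl_sub_orbit_stabilizer:
  "card (weyl_sub \<Phi> \<Delta> X) =
    card ((\<lambda>w. w v) ` weyl_sub \<Phi> \<Delta> X) * card {w \<in> weyl_sub \<Phi> \<Delta> X. w v = v}"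
proof -
  let ?W = "weyl_sub \<Phi> \<Delta> X" and ?S = "{w \<in> weyl_sub \<Phi> \<Delta> X. w v = v}"
  have fibre: "card {w \<in> ?W. w v = b} = card ?S" if "b \<in> (\<lambda>w. w v) ` ?W" for b
  proof -
    from that obtain as where as: "as \<in> lists (\<Delta> - X)" "b = refl_word as v"
      by (auto simp: weyl_sub_eq_words)
    have mult: "refl_word cs \<circ> w \<in> ?W" if "cs \<in> lists (\<Delta> - X)" "w \<in> ?W" for cs w
    proof -
      from that obtain bs where "bs \<in> lists (\<Delta> - X)" "w = refl_word bs"
        by (auto simp: weyl_sub_eq_words)
      with that show ?thesis
        unfolding weyl_sub_eq_words by (intro image_eqI [of _ _ "cs @ bs"]) (simp_all add: refl_word_append)
    qed
    have rev: "rev as \<in> lists (\<Delta> - X)"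
      using as by auto
    have "bij_betw (\<lambda>w. refl_word as \<circ> w) ?S {w \<in> ?W. w v = b}"
    proof (rule bij_betwI [where g = "\<lambda>w. refl_word (rev as) \<circ> w"])
      show "(\<lambda>w. refl_word as \<circ> w) \<in> ?S \<rightarrow> {w \<in> ?W. w v = b}"
        using as mult by auto
      show "(\<lambda>w. refl_word (rev as) \<circ> w) \<in> {w \<in> ?W. w v = b} \<rightarrow> ?S"
        using as mult [OF rev] by auto
    qed (auto simp: fun_eq_iff)
    then show ?thesis by (simp add: bij_betw_same_card)
  qed
  have "card ?W = (\<Sum>b\<in>(\<lambda>w. w v) ` ?W. card {w \<in> ?W. w v = b})"
    using sum.image_gen [OF finite_weyl_sub, of "\<lambda>_. 1::nat" X "\<lambda>w. w v"] by simp
  also have "\<dots> = (\<Sum>b\<in>(\<lambda>w. w v) ` ?W. card ?S)"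
    by (intro sum.cong fibre refl)
  finally show ?thesis by simp
qed

end

section \<open>Coordinates with respect to the simple roots\<close>

context
  fixes \<Phi> \<Delta> :: "'a::euclidean_space set"
  assumes \<Phi>: "root_system \<Phi>" and red: "reduced_roots \<Phi>" and simple: "simple_system \<Phi> \<Delta>"
begin

abbreviation coord :: "'a \<Rightarrow> 'a \<Rightarrow> real" where
  "coord \<equiv> representation \<Delta>"

lemma simple_subset: "\<Delta> \<subseteq> \<Phi>"
  and simple_independent: "independent \<Delta>"
  and simple_span: "x \<in> span \<Delta>"
  and simple_finite: "finite \<Delta>"
  using simple \<Phi> by (auto simp: simple_system_def root_system_def intro: finite_subset)

lemma simple_nonzero: "a \<in> \<Delta> \<Longrightarrow> a \<noteq> 0"
  using simple_subset \<Phi> by (auto simp: root_system_def)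

lemma coord_sign:
  assumes "b \<in> \<Phi>" "a \<in> \<Delta>" "coord b a > 0" "c \<in> \<Delta>"
  shows "coord b c \<ge> 0"
  using assms simple unfolding simple_system_def by (meson not_less)

lemma coord_simple: "a \<in> \<Delta> \<Longrightarrow> coord a b = (if b = a then 1 else 0)"
  using representation_basis [OF simple_independent] by auto

lemma sum_coord: "(\<Sum>a\<in>\<Delta>. coord x a *\<^sub>R a) = x"
  by (rule sum_representation_eq [OF simple_independent simple_span simple_finite order_refl])

lemma inner_sum_coord: "x \<bullet> y = (\<Sum>a\<in>\<Delta>. coord x a * (a \<bullet> y))"
  by (subst sum_coord [symmetric]) (simp add: inner_sum_left)

lemma coord_root_reflection:
  assumes "a \<in> \<Delta>"
  shows "coord (root_reflection a x) b = coord x b - (if b = a then 2 * (x \<bullet> a) / (a \<bullet> a) else 0)"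
  using assms
  by (simp add: root_reflection_def representation_diff [OF simple_independent simple_span simple_span]
      representation_scale [OF simple_independent simple_span] coord_simple)

lemma coord_refl_word:
  assumes "as \<in> lists \<Delta>" "b \<notin> set as"
  shows "coord (refl_word as x) b = coord x b"
  using assms by (induction as) (auto simp: coord_root_reflection)

text \<open>Otherwise reflecting a in b would give a root with coordinate 1 at a and a negative
  coordinate at b, against the sign condition.\<close>

lemma inner_simple_nonpos:
  assumes "a \<in> \<Delta>" "b \<in> \<Delta>" "a \<noteq> b"
  shows "a \<bullet> b \<le> 0"
proof (rule ccontr)
  assume "\<not> a \<bullet> b \<le> 0"
  then have "coord (root_reflection b a) b < 0"
    using assms simple_nonzero by (simp add: coord_root_reflection coord_simple)
  moreover have "coord (root_reflection b a) a > 0"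
    using assms by (simp add: coord_root_reflection coord_simple)
  moreover have "root_reflection b a \<in> \<Phi>"
    using assms simple_subset by (auto intro: root_reflection_closed [OF \<Phi> simple_subset])
  ultimately show False
    using coord_sign assms by force
qed

text \<open>The reflection changes only the coordinate at a. A positive coordinate elsewhere would
  survive and force the image to be positive, so b is a multiple of a, and reducedness with
  positivity leaves only a.\<close>

lemma root_reflection_not_positive:
  assumes b: "b \<in> \<Phi>" "\<forall>c\<in>\<Delta>. coord b c \<ge> 0" and a: "a \<in> \<Delta>"
    and neg: "\<not> (\<forall>c\<in>\<Delta>. coord (root_reflection a b) c \<ge> 0)"
  shows "b = a"
proof -
  have "root_reflection a b \<in> \<Phi>"
    using a b by (intro root_reflection_closed [OF \<Phi> simple_subset])
  have "coord b c = 0" if "c \<in> \<Delta> - {a}" for c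
  proof (rule ccontr)
    assume "coord b c \<noteq> 0"
    then have "coord (root_reflection a b) c > 0"
      using that b a by (simp add: coord_root_reflection order_less_le)
    then show False
      using neg coord_sign [OF \<open>root_reflection a b \<in> \<Phi>\<close>] that by blast
  qed
  then have "(\<Sum>c\<in>\<Delta>. coord b c *\<^sub>R c) = coord b a *\<^sub>R a"
    using a simple_finite by (subst sum.remove [of _ a]) auto
  then have "b = coord b a *\<^sub>R a"
    by (simp add: sum_coord)
  then have "coord b a = 1 \<or> coord b a = -1"
    using red b(1) a simple_subset unfolding reduced_roots_def by (metis subsetD)
  then have "coord b a = 1"
    using b(2) a by force
  with \<open>b = coord b a *\<^sub>R a\<close> show ?thesis by simp
qed

text \<open>Apply the letters to a from the right. The letter e that first turns the root negative
  must equal the positive root it acts on, and conjugation then cancels e against the final a. The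
  bound on \<open>set bs\<close> keeps the shorter word in the same generators.\<close>

lemma exchange:
  assumes "as \<in> lists \<Delta>" "a \<in> \<Delta>" "\<not> (\<forall>c\<in>\<Delta>. coord (refl_word as a) c \<ge> 0)"
  shows "\<exists>bs. length bs < length as \<and> set bs \<subseteq> set as \<and> refl_word (as @ [a]) = refl_word bs"
  using assms
proof (induction as)
  case Nil
  then show ?case by (auto simp: coord_simple split: if_splits)
next
  case (Cons e as)
  show ?case
  proof (cases "\<forall>c\<in>\<Delta>. coord (refl_word as a) c \<ge> 0")
    case True
    have "refl_word as a \<in> \<Phi>"
      using Cons.prems Cons.hyps simple_subset
      by (intro refl_word_closed [OF \<Phi> simple_subset]) auto
    then have "refl_word as a = e"
      using Cons.prems Cons.hyps True by (intro root_reflection_not_positive) auto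
    then have "refl_word ((e # as) @ [a]) = refl_word as"
      using refl_word_conjugate [of as a] by (simp add: refl_word_append fun_eq_iff)
    then show ?thesis by (intro exI [of _ as]) auto
  next
    case False
    with Cons obtain bs where "length bs < length as" "set bs \<subseteq> set as"
      "refl_word (as @ [a]) = refl_word bs" by auto
    then show ?thesis by (intro exI [of _ "e # bs"]) auto
  qed
qed

section \<open>The stabilizer of a simple root\<close>

lemma stabilizer_word:
  assumes "\<alpha> \<in> \<Delta>" "as \<in> lists (\<Delta> - {\<alpha>})" "refl_word as \<alpha> = \<alpha>"
  shows "\<exists>bs\<in>lists (\<Delta> - closed_nbhd \<Delta> \<alpha>). refl_word as = refl_word bs"
  using assms(2,3)
proof (induction as rule: length_induct)
  case (1 as)
  show ?case
  proof (cases as rule: rev_cases)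
    case Nil
    then show ?thesis by (intro bexI [of _ "[]"]) auto
  next
    case (snoc cs e)
    have cs: "cs \<in> lists (\<Delta> - {\<alpha>})" and e: "e \<in> \<Delta>" "e \<noteq> \<alpha>"
      using 1 snoc by auto
    have mono: "cs \<in> lists \<Delta>" using cs by auto
    show ?thesis
    \<comment> \<open>Instead of fixing a shortest word, the induction runs over all words: if the
      root before the last letter is not positive, \<open>exchange\<close> supplies a shorter word
      for the same map.\<close>
    proof (cases "\<forall>c\<in>\<Delta>. coord (refl_word cs e) c \<ge> 0")
      case False
      then obtain bs where "length bs < length cs" "set bs \<subseteq> set cs"
        "refl_word as = refl_word bs"
        using exchange [OF mono e(1)] snoc by blast
      then show ?thesis
        using 1 cs snoc
        by (metis (no_types, lifting) in_lists_conv_set length_append_singleton less_SucI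
            subset_code(1))
    next
      case True
      have "coord (refl_word cs e) \<alpha> = 0"
        using cs mono e assms(1) by (subst coord_refl_word) (auto simp: coord_simple)
      \<comment> \<open>Expanding in simple roots, the only possibly positive product, at \<alpha>
        itself, has coefficient 0.\<close>
      then have "refl_word cs e \<bullet> \<alpha> \<le> 0"
        using True inner_simple_nonpos [OF _ assms(1)]
        by (subst inner_sum_coord, intro sum_nonpos)
          (metis mult_nonneg_nonpos mult_eq_0_iff order_refl)
      moreover have "refl_word as e = - refl_word cs e"
        using e simple_nonzero
        by (simp add: snoc refl_word_append root_reflection_def scaleR_2
            flip: linear_neg [OF linear_refl_word])
      then have "e \<bullet> \<alpha> = - (refl_word cs e \<bullet> \<alpha>)"
        using inner_refl_word [of as e \<alpha>] "1.prems" by simp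
      ultimately have orth: "e \<bullet> \<alpha> = 0"
        using inner_simple_nonpos [OF e(1) assms(1) e(2)] by linarith
      then have "refl_word cs \<alpha> = \<alpha>"
        using "1.prems" snoc by (simp add: refl_word_append root_reflection_orthogonal inner_commute)
      then obtain bs where bs: "bs \<in> lists (\<Delta> - closed_nbhd \<Delta> \<alpha>)" "refl_word cs = refl_word bs"
        using 1 cs snoc by (metis length_append_singleton lessI)
      then have "refl_word as = refl_word (bs @ [e])"
        by (simp add: snoc refl_word_append)
      moreover have "bs @ [e] \<in> lists (\<Delta> - closed_nbhd \<Delta> \<alpha>)"
        using bs e orth by (auto simp: closed_nbhd_def)
      ultimately show ?thesis by blast
    qed
  qed
qed

lemma stabilizer_simple_root:
  assumes "\<alpha> \<in> \<Delta>"
  shows "{w \<in> weyl_sub \<Phi> \<Delta> {\<alpha>}. w \<alpha> = \<alpha>} = weyl_sub \<Phi> \<Delta> (closed_nbhd \<Delta> \<alpha>)"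
proof
  show "{w \<in> weyl_sub \<Phi> \<Delta> {\<alpha>}. w \<alpha> = \<alpha>} \<subseteq> weyl_sub \<Phi> \<Delta> (closed_nbhd \<Delta> \<alpha>)"
    using stabilizer_word [OF assms] unfolding weyl_sub_eq_words [OF \<Phi> simple_subset] by blast
  have "refl_word bs \<alpha> = \<alpha>" if "bs \<in> lists (\<Delta> - closed_nbhd \<Delta> \<alpha>)" for bs
    using that
    by (induction bs) (auto simp: closed_nbhd_def inner_commute intro!: root_reflection_orthogonal)
  moreover have "\<alpha> \<in> closed_nbhd \<Delta> \<alpha>"
    using assms simple_nonzero by (simp add: closed_nbhd_def)
  then have "lists (\<Delta> - closed_nbhd \<Delta> \<alpha>) \<subseteq> lists (\<Delta> - {\<alpha>})"
    by (intro lists_mono) auto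
  ultimately show "weyl_sub \<Phi> \<Delta> (closed_nbhd \<Delta> \<alpha>) \<subseteq> {w \<in> weyl_sub \<Phi> \<Delta> {\<alpha>}. w \<alpha> = \<alpha>}"
    by (auto simp: weyl_sub_eq_words [OF \<Phi> simple_subset])
qed

section \<open>Transitivity on the roots of coordinate 1 and given length\<close>

lemma transitive_word:
  assumes \<alpha>: "\<alpha> \<in> \<Delta>" and \<beta>: "\<beta> \<in> \<Phi>" "coord \<beta> \<alpha> = 1" "norm \<beta> = norm \<alpha>"
  shows "\<exists>as\<in>lists (\<Delta> - {\<alpha>}). refl_word as \<beta> = \<alpha>"
proof -
  define ht where "ht x = (\<Sum>a\<in>\<Delta>. coord x a)" for x
  define Orb where "Orb = (\<lambda>as. refl_word as \<beta>) ` lists (\<Delta> - {\<alpha>})"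
  have sub: "lists (\<Delta> - {\<alpha>}) \<subseteq> lists \<Delta>" by (intro lists_mono) auto
  then have "Orb \<subseteq> \<Phi>"
    using \<beta> by (auto simp: Orb_def intro!: refl_word_closed [OF \<Phi> simple_subset])
  then have "finite Orb" using \<Phi> by (auto simp: root_system_def intro: finite_subset)
  moreover have "Orb \<noteq> {}" by (auto simp: Orb_def)
  ultimately obtain \<gamma> where \<gamma>: "\<gamma> \<in> Orb" and min: "\<And>x. x \<in> Orb \<Longrightarrow> ht \<gamma> \<le> ht x"
    by (metis arg_min_if_finite(1) arg_min_least)
  from \<gamma> obtain as where as: "as \<in> lists (\<Delta> - {\<alpha>})" "\<gamma> = refl_word as \<beta>"
    by (auto simp: Orb_def)
  have \<gamma>1: "coord \<gamma> \<alpha> = 1"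
    unfolding as(2) using as(1) sub \<beta>(2) by (subst coord_refl_word) auto
  have norm: "norm \<gamma> = norm \<alpha>"
    using as \<beta> by (simp add: norm_refl_word)
  \<comment> \<open>Reflecting in such an a with positive product would lower the coordinate at a
    alone, hence the height, within the orbit.\<close>
  have anti: "a \<bullet> \<gamma> \<le> 0" if a: "a \<in> \<Delta> - {\<alpha>}" for a
  proof (rule ccontr)
    assume "\<not> a \<bullet> \<gamma> \<le> 0"
    then have "2 * (\<gamma> \<bullet> a) / (a \<bullet> a) > 0"
      using a simple_nonzero by (simp add: inner_commute)
    moreover have "ht (root_reflection a \<gamma>) = ht \<gamma> - 2 * (\<gamma> \<bullet> a) / (a \<bullet> a)"
      using a simple_finite by (simp add: ht_def coord_root_reflection sum_subtractf)
    moreover have "root_reflection a \<gamma> \<in> Orb"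
      using as a unfolding Orb_def by (auto intro!: image_eqI [of _ _ "a # as"])
    ultimately show False using min by force
  qed
  have "\<gamma> \<bullet> \<gamma> = \<alpha> \<bullet> \<gamma> + (\<Sum>a\<in>\<Delta> - {\<alpha>}. coord \<gamma> a * (a \<bullet> \<gamma>))"
    using \<alpha> simple_finite by (subst inner_sum_coord) (simp add: sum.remove \<gamma>1)
  \<comment> \<open>The coordinate 1 at \<alpha> makes \<gamma> a positive root, so each remaining
    term is a nonnegative coefficient times a nonpositive product.\<close>
  also have "\<dots> \<le> \<alpha> \<bullet> \<gamma>"
    using anti coord_sign [of \<gamma> \<alpha>] \<open>Orb \<subseteq> \<Phi>\<close> \<gamma> \<gamma>1 \<alpha>
    by (auto intro!: sum_nonpos mult_nonneg_nonpos)
  \<comment> \<open>With equal lengths, the left side is twice the difference of \<gamma> \<bullet>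
    \<gamma> and \<alpha> \<bullet> \<gamma>.\<close>
  finally have "(\<gamma> - \<alpha>) \<bullet> (\<gamma> - \<alpha>) \<le> 0"
    using norm by (simp add: norm_eq inner_diff_left inner_diff_right inner_commute)
  then have "\<gamma> = \<alpha>"
    by (metis eq_iff_diff_eq_0 inner_gt_zero_iff not_le)
  then show ?thesis using as by blast
qed

lemma orbit_simple_root:
  assumes "\<alpha> \<in> \<Delta>"
  shows "(\<lambda>w. w \<alpha>) ` weyl_sub \<Phi> \<Delta> {\<alpha>} = {\<beta> \<in> roots_of_coord \<Phi> \<Delta> \<alpha> 1. norm \<beta> = norm \<alpha>}"
proof
  have "coord (refl_word as \<alpha>) \<alpha> = 1" if "as \<in> lists (\<Delta> - {\<alpha>})" for as
    using that assms by (subst coord_refl_word) (auto simp: coord_simple)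
  then show "(\<lambda>w. w \<alpha>) ` weyl_sub \<Phi> \<Delta> {\<alpha>} \<subseteq> {\<beta> \<in> roots_of_coord \<Phi> \<Delta> \<alpha> 1. norm \<beta> = norm \<alpha>}"
    using assms simple_subset
    by (auto simp: weyl_sub_eq_words [OF \<Phi> simple_subset] roots_of_coord_def norm_refl_word
        in_lists_conv_set intro!: refl_word_closed [OF \<Phi> simple_subset])
  show "{\<beta> \<in> roots_of_coord \<Phi> \<Delta> \<alpha> 1. norm \<beta> = norm \<alpha>} \<subseteq> (\<lambda>w. w \<alpha>) ` weyl_sub \<Phi> \<Delta> {\<alpha>}"
  proof
    fix \<beta> assume "\<beta> \<in> {\<beta> \<in> roots_of_coord \<Phi> \<Delta> \<alpha> 1. norm \<beta> = norm \<alpha>}"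
    then obtain as where as: "as \<in> lists (\<Delta> - {\<alpha>})" "refl_word as \<beta> = \<alpha>"
      using transitive_word [OF assms] by (auto simp: roots_of_coord_def)
    then have "rev as \<in> lists (\<Delta> - {\<alpha>})"
      by auto
    then have "refl_word (rev as) \<in> weyl_sub \<Phi> \<Delta> {\<alpha>}"
      unfolding weyl_sub_eq_words [OF \<Phi> simple_subset] by blast
    moreover have "\<beta> = refl_word (rev as) \<alpha>"
      using as(2) by (metis refl_word_rev)
    ultimately show "\<beta> \<in> (\<lambda>w. w \<alpha>) ` weyl_sub \<Phi> \<Delta> {\<alpha>}" by blast
  qed
qed

end

theorem lemma8p1:
  fixes \<Phi> \<Delta> :: "'a::euclidean_space set" and \<alpha> :: 'a
  assumes "root_system \<Phi>" and "reduced_roots \<Phi>" and "crystallographic \<Phi>" and "irreducible_roots \<Phi>"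
    and "simple_system \<Phi> \<Delta>"
    and "\<alpha> \<in> \<Delta>"
  shows "real (card {\<beta> \<in> roots_of_coord \<Phi> \<Delta> \<alpha> 1. norm \<beta> = norm \<alpha>}) =
           real (card (weyl_sub \<Phi> \<Delta> {\<alpha>})) / real (card (weyl_sub \<Phi> \<Delta> (closed_nbhd \<Delta> \<alpha>)))"
proof -
  note root_simple = assms(1,2,5)
  have sub: "\<Delta> \<subseteq> \<Phi>" using assms(5) by (simp add: simple_system_def)
  \<comment> \<open>A finite group containing the identity has nonzero cardinality, which permits
    dividing the orbit-stabilizer identity.\<close>
  have "id \<in> weyl_sub \<Phi> \<Delta> (closed_nbhd \<Delta> \<alpha>)"
    by (auto simp: weyl_sub_eq_words [OF assms(1) sub] intro!: image_eqI [of _ _ "[]"])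
  then have "card (weyl_sub \<Phi> \<Delta> (closed_nbhd \<Delta> \<alpha>)) \<noteq> 0"
    using finite_weyl_sub [OF assms(1) sub] by auto
  then show ?thesis
    using weyl_sub_orbit_stabilizer [OF assms(1) sub, of "{\<alpha>}" \<alpha>]
    by (simp add: orbit_simple_root [OF root_simple assms(6)]
        stabilizer_simple_root [OF root_simple assms(6)])
qed

end
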